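(* For every integer $n\ge 1$, $$r(n,0)=\sum_{j=0}^{n-1}2^{j}\,r(n-1,j),$$ and for every integer $k$ with $1\le k\le n$, $$r(n,k)=r(n-1,k-1)+\sum_{j=k}^{n-1}2^{j-k}\,r(n-1,j),$$ where $r(n,k)$ is the number of Schröder paths of length $2n$ with exactly $k$ hills (empty sums are $0$).
   Context: A Schröder path of length $2n$ is a lattice path from $(0,0)$ to $(2n,0)$ consisting of up steps $U:(x,y)\to(x+1,y+1)$, down steps $D:(x,y)\to(x+1,y-1)$ and horizontal steps $H:(x,y)\to(x+2,y)$, that never goes below the $x$-axis. The empty path is the only Schröder path of length $0$. A peak is an up step immediately followed by a down step, $(x,y)\to(x+1,y+1)\to(x+2,y)$; its height is $y+1$. A hill is a peak at height $1$ (i.e. a consecutive $UD$ starting and ending on the $x$-axis). For $0\le k\le n$, $r(n,k)$ denotes the number of Schröder paths of length $2n$ with exactly $k$ hills; $r(0,0)=1$. *)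

theory Defs
  imports Main
begin

text \<open>A lattice path starting at the origin is represented by the list of its steps; the point
  reached after the first \<open>i\<close> steps of \<open>p\<close> is \<open>(path_x (take i p), path_y (take i p))\<close>.\<close>

datatype step = U | D | H

fun step_dx :: "step \<Rightarrow> nat" where
  "step_dx U = 1"
| "step_dx D = 1"
| "step_dx H = 2"

fun step_dy :: "step \<Rightarrow> int" where
  "step_dy U = 1"
| "step_dy D = -1"
| "step_dy H = 0"

definition path_x :: "step list \<Rightarrow> nat" where
  "path_x p = (\<Sum>s\<leftarrow>p. step_dx s)"

definition path_y :: "step list \<Rightarrow> int" where
  "path_y p = (\<Sum>s\<leftarrow>p. step_dy s)"

definition schroeder_path :: "nat \<Rightarrow> step list \<Rightarrow> bool" where
  "schroeder_path n p \<longleftrightarrow>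
     path_x p = 2 * n \<and> path_y p = 0 \<and> (\<forall>i\<le>length p. path_y (take i p) \<ge> 0)"

text \<open>A peak is identified by the index of its up step.\<close>

definition peaks :: "step list \<Rightarrow> nat set" where
  "peaks p = {i. Suc i < length p \<and> p ! i = U \<and> p ! Suc i = D}"

definition peak_height :: "step list \<Rightarrow> nat \<Rightarrow> int" where
  "peak_height p i = path_y (take i p) + 1"

definition hills :: "step list \<Rightarrow> nat set" where
  "hills p = {i \<in> peaks p. peak_height p i = 1}"

definition r :: "nat \<Rightarrow> nat \<Rightarrow> nat" where
  "r n k = card {p. schroeder_path n p \<and> card (hills p) = k}"

text \<open>The sets counted by \<^const>\<open>card\<close> above are finite.\<close>

lemma finite_hills: "finite (hills p)"
  by (rule finite_subset[of _ "{..<length p}"]) (auto simp: hills_def peaks_def)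

lemma length_le_path_x: "length p \<le> path_x p"
proof (induction p)
  case Nil
  show ?case by simp
next
  case (Cons s p)
  have "step_dx s \<ge> 1" by (cases s) auto
  with Cons.IH show ?case by (simp add: path_x_def)
qed

lemma finite_schroeder_paths: "finite {p. schroeder_path n p}"
proof (rule finite_subset)
  show "{p. schroeder_path n p} \<subseteq> {p. set p \<subseteq> {U, D, H} \<and> length p \<le> 2 * n}"
  proof
    fix p assume "p \<in> {p. schroeder_path n p}"
    then have "length p \<le> 2 * n"
      using length_le_path_x[of p] by (simp add: schroeder_path_def)
    moreover have "set p \<subseteq> {U, D, H}"
      using step.exhaust by blast
    ultimately show "p \<in> {p. set p \<subseteq> {U, D, H} \<and> length p \<le> 2 * n}" by simp
  qed
  show "finite {p. set p \<subseteq> {U, D, H} \<and> length p \<le> 2 * n}"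
    by (rule finite_lists_length_le) simp
qed

end

theory Submission
  imports Defs "HOL-Computational_Algebra.Formal_Power_Series"
begin

text \<open>First-return decomposition turns Schroeder paths into trees. Let \<open>R\<close> be the generating function
  of all Schroeder paths and \<open>F\<^sub>k\<close> that of the paths with exactly \<open>k\<close> hills. Apart from hills,
  the components of a path are \<open>H\<close> and \<open>U a D\<close> with \<open>a\<close> nonempty; reading \<open>H\<close> as the arch over
  the empty path, they are counted by \<open>x R\<close>. Hence \<open>F\<^sub>0 = 1 + x R F\<^sub>0\<close> and
  \<open>F\<^sub>k\<^sub>+\<^sub>1 = x F\<^sub>k + x R F\<^sub>k\<^sub>+\<^sub>1\<close>. Together with \<open>R = 1 + x R + x R\<^sup>2\<close>, in the form
  \<open>R (1 - x R) = (1 - x R) + 2 x R\<close>, this gives \<open>R F\<^sub>k = F\<^sub>k + 2 R F\<^sub>k\<^sub>+\<^sub>1\<close>, and iterating yields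
  \<open>R F\<^sub>k = (\<Sum>j\<ge>k. 2\<^sup>j\<^sup>-\<^sup>k F\<^sub>j)\<close>.\<close>

section \<open>Trees and the words they spell\<close>

datatype tree = Empty | Flat tree | Arch tree tree

fun word :: "tree \<Rightarrow> step list" where
  "word Empty = []"
| "word (Flat t) = H # word t"
| "word (Arch a b) = U # word a @ D # word b"

fun semilength :: "tree \<Rightarrow> nat" where
  "semilength Empty = 0"
| "semilength (Flat t) = Suc (semilength t)"
| "semilength (Arch a b) = Suc (semilength a + semilength b)"

text \<open>Only second subtrees are searched: the first subtree of \<open>Arch\<close> is traversed
  above the axis, where no peak is a hill. The arch itself is a hill when nothing lies beneath
  it.\<close>

fun hill_count :: "tree \<Rightarrow> nat" where
  "hill_count Empty = 0"
| "hill_count (Flat t) = hill_count t"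
| "hill_count (Arch a b) = (if a = Empty then 1 else 0) + hill_count b"

lemma path_x_simps [simp]:
  "path_x [] = 0" "path_x (s # p) = step_dx s + path_x p" "path_x (p @ q) = path_x p + path_x q"
  by (simp_all add: path_x_def)

lemma path_y_simps [simp]:
  "path_y [] = 0" "path_y (s # p) = step_dy s + path_y p" "path_y (p @ q) = path_y p + path_y q"
  by (simp_all add: path_y_def)

lemma path_x_word: "path_x (word t) = 2 * semilength t"
  by (induction t) auto

lemma path_y_word [simp]: "path_y (word t) = 0"
  by (induction t) auto

lemma path_y_take_word: "path_y (take i (word t)) \<ge> 0"
proof (induction t arbitrary: i)
  case Empty
  then show ?case by simp
next
  case (Flat t)
  then show ?case by (cases i) auto
next
  case (Arch a b)
  show ?case
  proof (cases i)
    case (Suc j)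
    show ?thesis
    proof (cases "j \<le> length (word a)")
      case True
      then show ?thesis using Suc Arch(1)[of j] by simp
    next
      case False
      \<comment> \<open>The prefix already contains \<open>U\<close>, all of \<open>word a\<close>
        and the closing \<open>D\<close>; \<open>m\<close> is what is left of the index for
        \<open>word b\<close>.\<close>
      then obtain m where "j - length (word a) = Suc m"
        by (metis Suc_diff_Suc not_le)
      then show ?thesis using Suc False Arch(2)[of m] by simp
    qed
  qed simp
qed

lemma schroeder_path_word: "schroeder_path n (word t) \<longleftrightarrow> semilength t = n"
  by (auto simp: schroeder_path_def path_x_word path_y_take_word)

section \<open>Unique readability and parsing of paths\<close>

text \<open>These are the lists that can remain when a maximal word has been read: the input is
  exhausted, or the next step closes an enclosing arch.\<close>

definition closed_suffix :: "step list \<Rightarrow> bool" where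
  "closed_suffix q \<longleftrightarrow> q = [] \<or> hd q = D"

lemma closed_suffix_simps [simp]:
  "closed_suffix []" "closed_suffix (s # q) \<longleftrightarrow> s = D"
  by (auto simp: closed_suffix_def)

text \<open>The first step determines the root constructor, since a closed suffix starts with
  neither \<open>U\<close> nor \<open>H\<close>. Suffixes are needed because the inner word of an
  arch is followed by \<open>D\<close>, which is again a closed suffix.\<close>

lemma word_append_eqD:
  assumes "word a @ u = word b @ v" "closed_suffix u" "closed_suffix v"
  shows "a = b \<and> u = v"
  using assms
proof (induction a arbitrary: b u v)
  case Empty
  then show ?case by (cases b) auto
next
  case (Flat t)
  then show ?case by (cases b) auto
next
  case (Arch a1 a2)
  obtain b1 b2 where b: "b = Arch b1 b2"
    using Arch.prems by (cases b) auto
  have "a1 = b1 \<and> D # word a2 @ u = D # word b2 @ v"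
    using Arch.prems(1) by (intro Arch.IH(1)) (simp_all add: b)
  then show ?case
    using Arch.IH(2)[of u b2 v] Arch.prems(2,3) by (simp add: b)
qed

lemma inj_word: "inj word"
  by (rule injI) (use word_append_eqD[of _ "[]" _ "[]"] in auto)

text \<open>A word has total height 0, so after an initial \<open>U\<close> the unread rest
  \<open>q\<close> has negative height; it is therefore nonempty and supplies the matching
  \<open>D\<close>. The inequality, unlike equality, passes to these remainders, which are shorter
  but need not be immediate tails.\<close>

lemma parse_word:
  assumes "path_y p \<le> 0"
  shows "\<exists>t q. p = word t @ q \<and> closed_suffix q"
  using assms
proof (induction p rule: length_induct)
  case (1 p)
  note IH = "1.IH"[rule_format]
  show ?case
  proof (cases p)
    case Nil
    then show ?thesis by (intro exI[of _ Empty]) auto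
  next
    case (Cons s p')
    show ?thesis
    proof (cases s)
      case D
      then show ?thesis using Cons by (intro exI[of _ Empty]) auto
    next
      case H
      then obtain t q where "p' = word t @ q \<and> closed_suffix q"
        using IH[of p'] "1.prems" Cons by auto
      then show ?thesis using Cons H by (intro exI[of _ "Flat t"]) auto
    next
      case U
      then obtain a q where a: "p' = word a @ q" "closed_suffix q"
        using IH[of p'] "1.prems" Cons by auto
      then obtain q' where q': "q = D # q'"
        using "1.prems" Cons U by (cases q) auto
      then obtain b q'' where "q' = word b @ q''" "closed_suffix q''"
        using IH[of q'] "1.prems" Cons U a by auto
      then show ?thesis using Cons U a q' by (intro exI[of _ "Arch a b"]) auto
    qed
  qed
qed

lemma schroeder_path_imp_word:
  assumes "schroeder_path n p"
  shows "\<exists>t. p = word t"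
proof -
  obtain t q where t: "p = word t @ q" "closed_suffix q"
    using parse_word[of p] assms by (auto simp: schroeder_path_def)
  have "q = []"
  proof (rule ccontr)
    assume "q \<noteq> []"
    with t obtain q' where "q = D # q'" by (cases q) auto
    \<comment> \<open>A leftover \<open>D\<close> would start at height 0 and leave the upper half
      plane.\<close>
    then have "path_y (take (Suc (length (word t))) p) = -1" "Suc (length (word t)) \<le> length p"
      using t by auto
    with assms show False by (fastforce simp: schroeder_path_def)
  qed
  with t show ?thesis by auto
qed

section \<open>Hills read off from the tree\<close>

text \<open>Hills of a path that starts at height \<open>h\<close> instead of \<open>0\<close>.\<close>

fun hills_from :: "int \<Rightarrow> step list \<Rightarrow> nat" where
  "hills_from h [] = 0"
| "hills_from h (s # p) =
     (if s = U \<and> h = 0 \<and> p \<noteq> [] \<and> hd p = D then 1 else 0) + hills_from (h + step_dy s) p"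

lemma peaks_Cons:
  "peaks (s # p) = (if s = U \<and> p \<noteq> [] \<and> hd p = D then {0} else {}) \<union> Suc ` peaks p"
proof (rule set_eqI)
  show "i \<in> peaks (s # p) \<longleftrightarrow>
      i \<in> (if s = U \<and> p \<noteq> [] \<and> hd p = D then {0} else {}) \<union> Suc ` peaks p" for i
    by (cases i) (auto simp: peaks_def hd_conv_nth)
qed

lemma finite_peaks: "finite (peaks p)"
  by (rule finite_subset[of _ "{..<length p}"]) (auto simp: peaks_def)

lemma card_hills_from: "card {i \<in> peaks p. h + path_y (take i p) = 0} = hills_from h p"
proof (induction p arbitrary: h)
  case Nil
  then show ?case by (simp add: peaks_def)
next
  case (Cons s p)
  let ?A = "if s = U \<and> h = 0 \<and> p \<noteq> [] \<and> hd p = D then {0::nat} else {}"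
  let ?B = "{i \<in> peaks p. (h + step_dy s) + path_y (take i p) = 0}"
  have "{i \<in> peaks (s # p). h + path_y (take i (s # p)) = 0} = ?A \<union> Suc ` ?B"
    by (auto simp: peaks_Cons split: if_splits)
  also have "card \<dots> = card ?A + card (Suc ` ?B)"
    by (rule card_Un_disjoint) (auto simp: finite_peaks)
  also have "\<dots> = hills_from h (s # p)"
    by (simp add: card_image Cons.IH)
  finally show ?case .
qed

text \<open>A word never descends below its starting height and returns to it, so from height at
  least 1 it has no up step leaving the axis.\<close>

lemma hills_from_word_append:
  "h \<ge> 1 \<Longrightarrow> hills_from h (word t @ u) = hills_from h u"
  by (induction t arbitrary: h u) auto

lemma hills_from_word: "hills_from 0 (word t) = hill_count t"
proof (induction t)
  case (Arch a b)
  \<comment> \<open>No word begins with \<open>D\<close>, so the leading \<open>U\<close> forms a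
    peak only over an empty subtree.\<close>
  have "(hd (word a @ D # word b) = D) \<longleftrightarrow> a = Empty"
    by (cases a) auto
  then show ?case
    by (simp add: hills_from_word_append Arch.IH)
qed auto

lemma card_hills_word: "card (hills (word t)) = hill_count t"
  using card_hills_from[of "word t" 0] by (simp add: hills_def peak_height_def hills_from_word)

lemma r_eq_card_trees: "r n k = card {t. semilength t = n \<and> hill_count t = k}"
proof -
  have "{p. schroeder_path n p \<and> card (hills p) = k}
      = word ` {t. semilength t = n \<and> hill_count t = k}"
  proof (rule set_eqI)
    show "p \<in> {p. schroeder_path n p \<and> card (hills p) = k}
        \<longleftrightarrow> p \<in> word ` {t. semilength t = n \<and> hill_count t = k}" for p
      using schroeder_path_imp_word[of n p] by (auto simp: schroeder_path_word card_hills_word)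
  qed
  then show ?thesis
    by (simp add: r_def card_image inj_on_subset[OF inj_word])
qed

lemma finite_semilength: "finite {t. semilength t = n \<and> P t}"
proof (rule finite_subset)
  show "finite (word -` {p. schroeder_path n p})"
    by (intro finite_vimageI finite_schroeder_paths inj_word)
qed (auto simp: schroeder_path_word)

section \<open>Recurrences from the first component\<close>

definition schroeder_number :: "nat \<Rightarrow> nat" where
  "schroeder_number n = card {t. semilength t = n}"

lemma semilength_eq_0_iff [simp]: "semilength t = 0 \<longleftrightarrow> t = Empty"
  by (cases t) auto

lemma finite_tree_pairs: "finite {(a, b). semilength a + semilength b = n \<and> P b}"
proof (rule finite_subset)
  show "finite (\<Union>i\<le>n. \<Union>j\<le>n. {a. semilength a = i \<and> True} \<times> {b. semilength b = j \<and> True})"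
    by (intro finite_UN_I finite_cartesian_product finite_semilength finite_atMost)
qed auto

lemma card_tree_pairs:
  "card {(a, b). semilength a + semilength b = n \<and> P b}
    = (\<Sum>i=0..n. schroeder_number i * card {b. semilength b = n - i \<and> P b})"
proof -
  let ?S = "\<lambda>i. {a. semilength a = i} \<times> {b. semilength b = n - i \<and> P b}"
  have fin: "finite (?S i)" for i
    using finite_semilength[of i "\<lambda>_. True"] finite_semilength by (intro finite_cartesian_product) auto
  have "{(a, b). semilength a + semilength b = n \<and> P b} = (\<Union>i\<in>{0..n}. ?S i)"
    by auto
  also have "card \<dots> = (\<Sum>i=0..n. card (?S i))"
    using fin by (intro card_UN_disjoint) auto
  finally show ?thesis
    by (simp add: card_cartesian_product schroeder_number_def)
qed

lemma schroeder_number_0: "schroeder_number 0 = 1"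
  by (simp add: schroeder_number_def)

lemma schroeder_number_Suc:
  "schroeder_number (Suc n)
    = schroeder_number n + (\<Sum>i=0..n. schroeder_number i * schroeder_number (n - i))"
proof -
  \<comment> \<open>The trivial conjunct makes this an instance of the pair lemmas, with a predicate
    that is always true.\<close>
  let ?P = "{(a, b). semilength a + semilength b = n \<and> True}"
  have "{t. semilength t = Suc n} = Flat ` {t. semilength t = n \<and> True} \<union> case_prod Arch ` ?P"
  proof (rule set_eqI)
    show "t \<in> {t. semilength t = Suc n} \<longleftrightarrow>
        t \<in> Flat ` {t. semilength t = n \<and> True} \<union> case_prod Arch ` ?P" for t
      by (cases t) (auto simp: image_iff)
  qed
  also have "card \<dots> = card (Flat ` {t. semilength t = n \<and> True}) + card (case_prod Arch ` ?P)"
    by (intro card_Un_disjoint finite_imageI finite_semilength finite_tree_pairs) auto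
  also have "\<dots> = card {t. semilength t = n \<and> True} + card ?P"
  proof -
    have "inj Flat" "inj (case_prod Arch)"
      by (auto simp: inj_on_def)
    then show ?thesis by (simp only: card_image inj_on_subset[OF _ subset_UNIV])
  qed
  finally show ?thesis
    unfolding card_tree_pairs by (simp add: schroeder_number_def)
qed

lemma r_0: "r 0 k = (if k = 0 then 1 else 0)"
proof -
  have "{t. semilength t = 0 \<and> hill_count t = k} = (if k = 0 then {Empty} else {})"
    by auto
  then show ?thesis by (simp add: r_eq_card_trees)
qed

lemma r_Suc:
  "r (Suc n) k = (if k = 0 then 0 else r n (k - 1))
    + (\<Sum>i=0..n. schroeder_number i * r (n - i) k)"
proof -
  let ?P = "{(a, b). semilength a + semilength b = n \<and> hill_count b = k}"
  \<comment> \<open>With \<open>Suc\<close> on the left, the set is empty for \<open>k = 0\<close>,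
    when no path can begin with a hill.\<close>
  let ?Q = "{b. semilength b = n \<and> Suc (hill_count b) = k}"
  \<comment> \<open>Replacing the hill by a flat step of the same semilength lets \<open>a\<close>
    range over all trees: \<open>f\<close> enumerates exactly the trees whose first component is not
    a hill.\<close>
  define f where "f = (\<lambda>(a, b). if a = Empty then Flat b else Arch a b)"
  have f_neq: "Arch Empty b \<noteq> f p" for b p
    by (cases p) (simp add: f_def)
  have "inj (Arch Empty)"
    by (rule injI) simp
  have "inj f"
    unfolding f_def by (rule injI) (clarsimp split: if_splits)
  have "finite ?P" "finite ?Q"
    by (rule finite_tree_pairs, rule finite_semilength)
  have trees: "{t. semilength t = Suc n \<and> hill_count t = k} = Arch Empty ` ?Q \<union> f ` ?P"
  proof (rule set_eqI)
    show "t \<in> {t. semilength t = Suc n \<and> hill_count t = k} \<longleftrightarrow> t \<in> Arch Empty ` ?Q \<union> f ` ?P" for t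
      by (cases t) (force simp: f_def image_iff split: if_splits)+
  qed
  have "r (Suc n) k = card (Arch Empty ` ?Q \<union> f ` ?P)"
    by (simp only: r_eq_card_trees trees)
  also have "\<dots> = card (Arch Empty ` ?Q) + card (f ` ?P)"
    using \<open>finite ?P\<close> \<open>finite ?Q\<close> f_neq by (intro card_Un_disjoint finite_imageI) blast+
  also have "\<dots> = card ?Q + card ?P"
    using \<open>inj (Arch Empty)\<close> \<open>inj f\<close> by (simp only: card_image inj_on_subset[OF _ subset_UNIV])
  also have "card ?Q = (if k = 0 then 0 else r n (k - 1))"
    by (cases k) (simp_all add: r_eq_card_trees)
  finally show ?thesis
    unfolding card_tree_pairs by (simp add: r_eq_card_trees)
qed

lemma r_eq_0: "n < k \<Longrightarrow> r n k = 0"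
proof (induction n arbitrary: k rule: less_induct)
  case (less n)
  then show ?case by (cases n) (auto simp: r_0 r_Suc)
qed

section \<open>Generating functions and the convolution identity\<close>

definition schroeder_fps :: "int fps" where
  "schroeder_fps = Abs_fps (\<lambda>n. int (schroeder_number n))"

definition hill_fps :: "nat \<Rightarrow> int fps" where
  "hill_fps k = Abs_fps (\<lambda>n. int (r n k))"

lemma schroeder_fps_eq:
  "schroeder_fps = 1 + fps_X * schroeder_fps + fps_X * (schroeder_fps * schroeder_fps)"
proof (rule fps_ext)
  show "fps_nth schroeder_fps n = fps_nth (1 + fps_X * schroeder_fps
      + fps_X * (schroeder_fps * schroeder_fps)) n" for n
    \<comment> \<open>The instance expands only products whose left factor is a generating function;
      multiplication by \<open>fps_X\<close> remains a coefficient shift.\<close>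
    by (cases n) (simp_all add: schroeder_fps_def schroeder_number_0 schroeder_number_Suc
        fps_mult_nth[of "Abs_fps _"])
qed

lemma hill_fps_Suc:
  "hill_fps (Suc k) = fps_X * hill_fps k + fps_X * (schroeder_fps * hill_fps (Suc k))"
proof (rule fps_ext)
  show "fps_nth (hill_fps (Suc k)) n
      = fps_nth (fps_X * hill_fps k + fps_X * (schroeder_fps * hill_fps (Suc k))) n" for n
    by (cases n) (simp_all add: schroeder_fps_def hill_fps_def r_0 r_Suc fps_mult_nth[of "Abs_fps _"])
qed

lemma schroeder_mult_hill_fps:
  "schroeder_fps * hill_fps k = hill_fps k + 2 * (schroeder_fps * hill_fps (Suc k))"
proof -
  \<comment> \<open>The identity is proved after multiplication by \<open>Q\<close>. Since the
    constant term of \<open>Q\<close> is 1 and integer power series form an integral domain,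
    \<open>Q\<close> can be cancelled.\<close>
  define Q where "Q = 1 - fps_X * schroeder_fps"
  have "fps_nth Q 0 \<noteq> 0"
    by (simp add: Q_def)
  then have "Q \<noteq> 0" by auto
  have R: "schroeder_fps * Q = Q + 2 * (fps_X * schroeder_fps)"
  proof -
    have "schroeder_fps * Q = schroeder_fps - fps_X * (schroeder_fps * schroeder_fps)"
      by (simp add: Q_def algebra_simps)
    also have "\<dots> = 1 + fps_X * schroeder_fps"
      using schroeder_fps_eq by (simp only: diff_eq_eq)
    finally show ?thesis by (simp add: Q_def)
  qed
  have F: "Q * hill_fps (Suc k) = fps_X * hill_fps k"
  proof -
    have "hill_fps (Suc k) - fps_X * (schroeder_fps * hill_fps (Suc k)) = fps_X * hill_fps k"
      using hill_fps_Suc[of k] by (simp only: diff_eq_eq)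
    then show ?thesis by (simp add: Q_def algebra_simps)
  qed
  have "Q * (schroeder_fps * hill_fps k) = (schroeder_fps * Q) * hill_fps k"
    by (simp only: mult_ac)
  also have "\<dots> = Q * hill_fps k + 2 * schroeder_fps * (fps_X * hill_fps k)"
    unfolding R by (simp add: algebra_simps)
  also have "\<dots> = Q * (hill_fps k + 2 * (schroeder_fps * hill_fps (Suc k)))"
    unfolding F[symmetric] by (simp add: algebra_simps)
  finally have "Q * (schroeder_fps * hill_fps k)
      = Q * (hill_fps k + 2 * (schroeder_fps * hill_fps (Suc k)))" .
  with \<open>Q \<noteq> 0\<close> show ?thesis by simp
qed

lemma schroeder_hill_convolution:
  "(\<Sum>i=0..n. schroeder_number i * r (n - i) k) = (\<Sum>j=k..n. 2 ^ (j - k) * r n j)"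
proof -
  define G where "G = (\<lambda>k. \<Sum>i=0..n. schroeder_number i * r (n - i) k)"
  have nth: "fps_nth (schroeder_fps * hill_fps k) n = int (G k)" for k
    by (simp add: fps_mult_nth schroeder_fps_def hill_fps_def G_def)
  have G_rec: "G k = r n k + 2 * G (Suc k)" for k
  proof -
    have "int (G k) = int (r n k) + 2 * int (G (Suc k))"
      using arg_cong[OF schroeder_mult_hill_fps[of k], of "\<lambda>f. fps_nth f n"]
      unfolding mult_2 fps_add_nth nth by (simp add: hill_fps_def)
    then show ?thesis by linarith
  qed
  \<comment> \<open>More hills than the semilength are impossible; this gives the recursion
    \<open>G_rec\<close> its starting value, from which \<open>k\<close> descends.\<close>
  have zero: "G k = 0" if "n < k" for k
    using that by (simp add: G_def r_eq_0)
  have "G k = (\<Sum>j=k..n. 2 ^ (j - k) * r n j)"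
  proof (cases "k \<le> n")
    case True
    then show ?thesis
    proof (induction k rule: inc_induct)
      case base
      then show ?case by (simp add: G_rec[of n] zero)
    next
      case (step k)
      have "(\<Sum>j=k..n. 2 ^ (j - k) * r n j) = r n k + (\<Sum>j=Suc k..n. 2 ^ (j - k) * r n j)"
        using step.hyps by (simp add: sum.atLeast_Suc_atMost)
      also have "(\<Sum>j=Suc k..n. 2 ^ (j - k) * r n j) = 2 * (\<Sum>j=Suc k..n. 2 ^ (j - Suc k) * r n j)"
        unfolding sum_distrib_left
      proof (intro sum.cong refl)
        fix j assume "j \<in> {Suc k..n}"
        then have "j - k = Suc (j - Suc k)" by auto
        then show "2 ^ (j - k) * r n j = 2 * (2 ^ (j - Suc k) * r n j)" by simp
      qed
      finally show ?case
        using G_rec[of k] step.IH by simp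
    qed
  qed (simp add: zero)
  then show ?thesis by (simp add: G_def)
qed

theorem theorem1p1:
  fixes n :: nat
  assumes "n \<ge> 1"
  shows "r n 0 = (\<Sum>j = 0..n - 1. 2 ^ j * r (n - 1) j) \<and>
    (\<forall>k. 1 \<le> k \<and> k \<le> n \<longrightarrow>
      r n k = r (n - 1) (k - 1) + (\<Sum>j = k..n - 1. 2 ^ (j - k) * r (n - 1) j))"
proof -
  obtain m where "n = Suc m"
    using assms by (cases n) auto
  then show ?thesis
    by (auto simp: r_Suc schroeder_hill_convolution)
qed

end
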